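(* Let $\Lambda\subset\mathbb{N}_0^d$ be an arbitrary finite index set. A rank-1 lattice rule $Q_n^*$ with $n$ points and generating vector $\boldsymbol{z}\in\mathbb{Z}^d$ reconstructs exactly the Chebyshev coefficients of all Chebyshev space functions $f\in\mathcal{F}^{\rm Cheb}_\Lambda$ solely supported on $\Lambda$, by $$\widehat f_{\boldsymbol{k}}=\widehat f^{\,c}_{\boldsymbol{k}}:=\frac{Q_n^*\big(f(\cos(2\pi\,\bullet\,))\,\sqrt2^{\,|\boldsymbol{k}|_0}\cos(2\pi\boldsymbol{k}\cdot\,\bullet\,)\big)}{c_{\boldsymbol{k}}},\qquad c_{\boldsymbol{k}}:=\#\{\boldsymbol{\sigma}\in\mathcal{S}_{\boldsymbol{k}}:\boldsymbol{\sigma}(\boldsymbol{k})\cdot\boldsymbol{z}\equiv\boldsymbol{k}\cdot\boldsymbol{z}\ (\mathrm{mod}\ n)\},\qquad\text{for all }\boldsymbol{k}\in\Lambda,$$ if and only if $$\boldsymbol{\sigma}(\boldsymbol{k}')\cdot\boldsymbol{z}\not\equiv\boldsymbol{k}\cdot\boldsymbol{z}\pmod n\qquad\text{for all }\boldsymbol{k},\boldsymbol{k}'\in\Lambda,\ \boldsymbol{\sigma}\in\mathcal{S}_{\boldsymbol{k}'},\ \boldsymbol{k}\ne\boldsymbol{k}'.$$ Such a generating vector $\boldsymbol{z}$ can be constructed component-by-component if $n$ is a prime satisfying $$n>\max\{\#\Lambda\cdot\#\mathcal{M}(\Lambda),\ 2\max(\Lambda)\}.$$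
   Context: Chebyshev basis on $[-1,1]^d$: $\eta_{\boldsymbol{k}}(\boldsymbol{x})=\sqrt2^{\,|\boldsymbol{k}|_0}\prod_{j=1}^dT_{k_j}(x_j)$, $\boldsymbol{k}\in\mathbb{N}_0^d$, $T_k(x)=\cos(k\arccos x)$, $|\boldsymbol{k}|_0$ the number of nonzero components. $\mathcal{F}^{\rm Cheb}_\Lambda$ is the set of real-valued functions $f=\sum_{\boldsymbol{k}\in\Lambda}\widehat f_{\boldsymbol{k}}\,\eta_{\boldsymbol{k}}$ on $[-1,1]^d$; the Chebyshev coefficients are $\widehat f_{\boldsymbol{k}}=\int_{[-1,1]^d}f\,\eta_{\boldsymbol{k}}\,\mu(d\boldsymbol{x})$ with $\mu(d\boldsymbol{x})=d\boldsymbol{x}/\prod_{j=1}^d(\pi\sqrt{1-x_j^2})$. The rank-1 lattice rule is $Q_n^*(g)=\frac1n\sum_{i=0}^{n-1}g\big(\frac{i\boldsymbol{z}\bmod n}{n}\big)$ (mod applied componentwise); $f(\cos(2\pi\,\bullet))$ denotes $\boldsymbol{x}\mapsto f(\cos(2\pi x_1),\ldots,\cos(2\pi x_d))$ and $\cos(2\pi\boldsymbol{k}\cdot\bullet)$ denotes $\boldsymbol{x}\mapsto\cos(2\pi\boldsymbol{k}\cdot\boldsymbol{x})$. $\boldsymbol{\sigma}(\boldsymbol{k})=(\sigma_1k_1,\ldots,\sigma_dk_d)$; $\mathcal{S}_{\boldsymbol{k}}=\{\boldsymbol{\sigma}\in\{\pm1\}^d:\sigma_j=+1\text{ if }k_j=0\}$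 (and likewise in dimension $s$); $\mathcal{M}(\Lambda)=\{\boldsymbol{\sigma}(\boldsymbol{k}):\boldsymbol{k}\in\Lambda,\boldsymbol{\sigma}\in\{\pm1\}^d\}$; $\max(\Lambda)=\max_{\boldsymbol{k}\in\Lambda}\max_j|k_j|$; $\#$ is cardinality. "Constructed component-by-component": let $\Lambda_s=\{\boldsymbol{k}\in\mathbb{N}_0^s:(\boldsymbol{k},\boldsymbol{k}_\perp)\in\Lambda\text{ for some }\boldsymbol{k}_\perp\in\mathbb{N}_0^{d-s}\}$. The components $z_1,\ldots,z_d\in\{1,\ldots,n-1\}$ can be chosen one at a time: whenever $(z_1,\ldots,z_{s-1})$ satisfies $\boldsymbol{\sigma}(\boldsymbol{k}')\cdot(z_1,\ldots,z_{s-1})\not\equiv\boldsymbol{k}\cdot(z_1,\ldots,z_{s-1})\pmod n$ for all $\boldsymbol{k}\ne\boldsymbol{k}'$ in $\Lambda_{s-1}$ and $\boldsymbol{\sigma}\in\mathcal{S}_{\boldsymbol{k}'}$ (no condition if $s=1$), there exists $z_s\in\{1,\ldots,n-1\}$ such that $(z_1,\ldots,z_s)$ satisfies the same condition with $\Lambda_s$. Since $\Lambda_d=\Lambda$, the resulting $\boldsymbol{z}$ satisfies the required condition. *)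

theory Defs
  imports "HOL-Analysis.Analysis" "HOL-Number_Theory.Cong"
    "HOL-Computational_Algebra.Primes"
begin

text \<open>
  Vectors of length \<open>s\<close> over \<open>A\<close> are the extensional functions in
  \<open>{..<s} \<rightarrow>\<^sub>E A\<close>; the component written \<open>z\<^sub>j\<close> on paper, with
  \<open>1 \<le> j \<le> s\<close>, is \<open>z (j - 1)\<close> here. Extensionality makes vectors determined by their
  components, so that \<open>=\<close> and \<open>card\<close> have their usual meaning. The dimension is a
  natural number because the component-by-component construction moves from length
  \<open>s\<close> to length \<open>s + 1\<close>.
\<close>

definition chebT :: "nat \<Rightarrow> real \<Rightarrow> real" where
  "chebT k x = cos (real k * arccos x)"

definition nnz :: "nat \<Rightarrow> (nat \<Rightarrow> nat) \<Rightarrow> nat" where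
  "nnz d k = card {j \<in> {..<d}. k j \<noteq> 0}"

definition cheb_basis :: "nat \<Rightarrow> (nat \<Rightarrow> nat) \<Rightarrow> (nat \<Rightarrow> real) \<Rightarrow> real" where
  "cheb_basis d k x = sqrt 2 ^ nnz d k * (\<Prod>j<d. chebT (k j) (x j))"

definition cube :: "nat \<Rightarrow> (nat \<Rightarrow> real) set" where
  "cube d = {..<d} \<rightarrow>\<^sub>E {-1..1}"

text \<open>
  The density formula is meaningful only on the cube, and integrals with respect to this
  measure are taken over the cube only. The points with some \<open>x j = 1\<close> or
  \<open>x j = -1\<close>, where the quotient is \<open>0\<close> by convention, form a null set.
\<close>

definition cheb_measure :: "nat \<Rightarrow> (nat \<Rightarrow> real) measure" where
  "cheb_measure d =
     density (PiM {..<d} (\<lambda>_. lborel))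
       (\<lambda>x. ennreal (1 / (\<Prod>j<d. pi * sqrt (1 - (x j)\<^sup>2))))"

definition cheb_coeff :: "nat \<Rightarrow> ((nat \<Rightarrow> real) \<Rightarrow> real) \<Rightarrow> (nat \<Rightarrow> nat) \<Rightarrow> real" where
  "cheb_coeff d f k = (LINT x:cube d|cheb_measure d. f x * cheb_basis d k x)"

text \<open>
  A function on the cube is represented by a total function whose values off the cube
  are arbitrary and are never used.
\<close>

definition cheb_space :: "nat \<Rightarrow> (nat \<Rightarrow> nat) set \<Rightarrow> ((nat \<Rightarrow> real) \<Rightarrow> real) set" where
  "cheb_space d \<Lambda> =
     {f. \<forall>x\<in>cube d. f x = (\<Sum>k\<in>\<Lambda>. cheb_coeff d f k * cheb_basis d k x)}"

definition lattice_rule ::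
    "nat \<Rightarrow> nat \<Rightarrow> (nat \<Rightarrow> int) \<Rightarrow> ((nat \<Rightarrow> real) \<Rightarrow> real) \<Rightarrow> real" where
  "lattice_rule d n z g =
     1 / real n *
       (\<Sum>i<n. g (\<lambda>j\<in>{..<d}. real_of_int ((int i * z j) mod int n) / real n))"

definition dot_cong :: "nat \<Rightarrow> nat \<Rightarrow> (nat \<Rightarrow> int) \<Rightarrow> (nat \<Rightarrow> int) \<Rightarrow> (nat \<Rightarrow> int) \<Rightarrow> bool" where
  "dot_cong s n a b z \<longleftrightarrow> [(\<Sum>j<s. a j * z j) = (\<Sum>j<s. b j * z j)] (mod int n)"

definition sign_change :: "nat \<Rightarrow> (nat \<Rightarrow> int) \<Rightarrow> (nat \<Rightarrow> nat) \<Rightarrow> (nat \<Rightarrow> int)" where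
  "sign_change s \<sigma> k = (\<lambda>j\<in>{..<s}. \<sigma> j * int (k j))"

definition sign_set :: "nat \<Rightarrow> (nat \<Rightarrow> nat) \<Rightarrow> (nat \<Rightarrow> int) set" where
  "sign_set s k = {\<sigma> \<in> {..<s} \<rightarrow>\<^sub>E {-1, 1}. \<forall>j<s. k j = 0 \<longrightarrow> \<sigma> j = 1}"

definition mirrored :: "nat \<Rightarrow> (nat \<Rightarrow> nat) set \<Rightarrow> (nat \<Rightarrow> int) set" where
  "mirrored d \<Lambda> = {sign_change d \<sigma> k | \<sigma> k. k \<in> \<Lambda> \<and> \<sigma> \<in> {..<d} \<rightarrow>\<^sub>E {-1, 1}}"

text \<open>The inserted \<open>0\<close> matters only for empty \<open>\<Lambda>\<close>.\<close>

definition max_index :: "nat \<Rightarrow> (nat \<Rightarrow> nat) set \<Rightarrow> nat" where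
  "max_index d \<Lambda> = Max (insert 0 {k j | k j. k \<in> \<Lambda> \<and> j < d})"

definition sign_count :: "nat \<Rightarrow> nat \<Rightarrow> (nat \<Rightarrow> int) \<Rightarrow> (nat \<Rightarrow> nat) \<Rightarrow> nat" where
  "sign_count d n z k =
     card {\<sigma> \<in> sign_set d k. dot_cong d n (sign_change d \<sigma> k) (\<lambda>j. int (k j)) z}"

definition lattice_coeff ::
    "nat \<Rightarrow> nat \<Rightarrow> (nat \<Rightarrow> int) \<Rightarrow> ((nat \<Rightarrow> real) \<Rightarrow> real) \<Rightarrow> (nat \<Rightarrow> nat) \<Rightarrow> real" where
  "lattice_coeff d n z f k =
     lattice_rule d n z
       (\<lambda>x. f (\<lambda>j\<in>{..<d}. cos (2 * pi * x j)) *
            (sqrt 2 ^ nnz d k * cos (2 * pi * (\<Sum>j<d. real (k j) * x j))))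
     / real (sign_count d n z k)"

definition separating :: "nat \<Rightarrow> nat \<Rightarrow> (nat \<Rightarrow> nat) set \<Rightarrow> (nat \<Rightarrow> int) \<Rightarrow> bool" where
  "separating s n \<Lambda> z \<longleftrightarrow>
     (\<forall>k\<in>\<Lambda>. \<forall>k'\<in>\<Lambda>. \<forall>\<sigma>\<in>sign_set s k'. k \<noteq> k' \<longrightarrow>
        \<not> dot_cong s n (sign_change s \<sigma> k') (\<lambda>j. int (k j)) z)"

text \<open>\<open>merge\<close> concatenates a vector of length \<open>s\<close> with one indexed by the remaining
  positions.\<close>

definition proj_index :: "nat \<Rightarrow> nat \<Rightarrow> (nat \<Rightarrow> nat) set \<Rightarrow> (nat \<Rightarrow> nat) set" where
  "proj_index d s \<Lambda> =
     {k \<in> {..<s} \<rightarrow>\<^sub>E UNIV. \<exists>k' \<in> {s..<d} \<rightarrow>\<^sub>E UNIV. merge {..<s} {s..<d} (k, k') \<in> \<Lambda>}"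

end

theory Submission
  imports Defs
begin

text \<open>
  Under the substitution \<open>x\<^sub>j = cos (2\<pi> t\<^sub>j)\<close> the basis function with index \<open>l\<close> becomes,
  up to its normalisation, the product of the \<open>cos (2\<pi> l\<^sub>j t\<^sub>j)\<close>, and this product is the average
  over the sign vectors \<open>\<sigma>\<close> in the sign set of \<open>l\<close> of the cosine waves with frequencies
  \<open>\<sigma>(l)\<close>. A rank-1 lattice rule sees the wave with an integer frequency \<open>h\<close> only through the
  residue of \<open>h \<cdot> z\<close> modulo \<open>n\<close>, and it integrates that wave to \<open>1\<close> if this residue is
  \<open>0\<close> and to \<open>0\<close> otherwise. Hence the rule applied to basis function \<open>l\<close> against test function
  \<open>k\<close> gives a positive factor times the number of \<open>\<sigma>\<close> with \<open>\<sigma>(l) \<cdot> z \<equiv> k \<cdot> z\<close>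
  (\<open>sum_lattice_prod_cos\<close>). The discrete coefficient of \<open>f\<close> at \<open>k\<close> is therefore a linear
  combination of the true coefficients (\<open>lattice_coeff_expansion\<close>). Division by \<open>c\<^sub>k\<close> makes the
  weight of the coefficient at \<open>k\<close> itself equal to \<open>1\<close>; the other weights are nonnegative and vanish
  together exactly when \<open>z\<close> separates the index set. This gives sufficiency at once. For necessity the
  formula is applied to the basis functions, which lie in the Chebyshev space because they are orthonormal
  (\<open>cheb_coeff_basis\<close>).

  For the component-by-component construction, suppose that a new last component \<open>w\<close> makes
  \<open>\<sigma>(k')\<close> and \<open>k\<close> collide. If the last entries of \<open>\<sigma>(k')\<close> and \<open>k\<close> agree, they cancel
  and the truncations of \<open>k\<close> and \<open>k'\<close>, which still differ, already collide; the
  hypothesis on the earlier components forbids this. Otherwise the difference of the last entries is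
  nonzero and smaller than the prime \<open>n\<close> in absolute value, so it is invertible and excludes at
  most one \<open>w\<close>. If the index set is nonempty, there are fewer than \<open>n - 1\<close> such pairs
  \<open>(k, \<sigma>(k'))\<close>, so that some \<open>w\<close> survives
  (\<open>separating_extension\<close>).
\<close>

section \<open>Orthonormality of the Chebyshev basis\<close>

text \<open>
  The angles \<open>t\<close> and \<open>arccos (cos t)\<close> have the same cosine, and by the three-term recurrence
  \<open>cos ((k + 2) t) = 2 cos t cos ((k + 1) t) - cos (k t)\<close> the cosine of an angle determines the
  cosines of all its multiples.
\<close>

lemma chebT_cos: "chebT k (cos t) = cos (real k * t)"
proof -
  have "cos (real k * a) = cos (real k * b)" if "cos a = cos b" for a b
  proof (induction k rule: induct_nat_012)
    case (ge2 k)
    have step: "cos (real (Suc (Suc k)) * c) = 2 * cos c * cos (real (Suc k) * c) - cos (real k * c)" for c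
      using cos_add[of "real (Suc k) * c" c] cos_diff[of "real (Suc k) * c" c]
      by (simp add: algebra_simps)
    show ?case
      unfolding step using ge2 that by simp
  qed (use that in auto)
  then show ?thesis
    unfolding chebT_def by (metis cos_arccos cos_ge_minus_one cos_le_one)
qed

lemma chebT_mult:
  assumes "k \<le> l"
  shows "chebT k x * chebT l x = (chebT (l + k) x + chebT (l - k) x) / 2"
  using assms cos_times_cos[of "real l * arccos x" "real k * arccos x"]
  by (simp add: chebT_def of_nat_diff algebra_simps)

lemma continuous_on_chebT: "continuous_on {-1..1} (chebT k)"
  unfolding chebT_def by (intro continuous_intros) auto

lemma chebT_weight_measurable:
  "(\<lambda>x. indicator {-1..1} x *\<^sub>R (chebT m x / (pi * sqrt (1 - x\<^sup>2)))) \<in> borel_measurable borel"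
proof -
  have "(\<lambda>x. (indicator {-1..1} x *\<^sub>R chebT m x) / (pi * sqrt (1 - x\<^sup>2))) \<in> borel_measurable borel"
    by (intro borel_measurable_divide borel_measurable_continuous_on_indicator continuous_on_chebT)
       simp_all
  then show ?thesis by simp
qed

text \<open>
  The substitution \<open>x = cos t\<close> in the form of an antiderivative, continuous up to the
  endpoints although the integrand is unbounded there.
\<close>

lemma chebT_weight_has_integral:
  "((\<lambda>x. chebT m x / (pi * sqrt (1 - x\<^sup>2))) has_integral (if m = 0 then 1 else 0)) {-1..1}"
proof -
  define F where "F = (\<lambda>x. if m = 0 then - arccos x / pi else - sin (real m * arccos x) / (real m * pi))"
  have "((\<lambda>x. chebT m x / (pi * sqrt (1 - x\<^sup>2))) has_integral (F 1 - F (-1))) {-1..1}"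
  proof (rule fundamental_theorem_of_calculus_interior)
    show "continuous_on {-1..1} F"
      by (cases "m = 0") (auto simp: F_def intro!: continuous_intros)
    show "(F has_vector_derivative chebT m x / (pi * sqrt (1 - x\<^sup>2))) (at x)"
      if "x \<in> {-1<..<1}" for x
      unfolding has_real_derivative_iff_has_vector_derivative [symmetric] F_def chebT_def
      using that
      by (cases "m = 0") (auto intro!: derivative_eq_intros simp: divide_simps)
  qed simp
  moreover have "F 1 - F (-1) = (if m = 0 then 1 else 0)"
    by (simp add: F_def)
  ultimately show ?thesis by simp
qed

text \<open>
  A convergent gauge integral of a nonnegative function is a Lebesgue integral, which settles
  \<open>m = 0\<close>. That case dominates all others since \<open>\<bar>T\<^sub>m\<bar> \<le> 1 = T\<^sub>0\<close>.
\<close>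

lemma chebT_weight_integrable:
  "set_integrable lborel {-1..1} (\<lambda>x. chebT m x / (pi * sqrt (1 - x\<^sup>2)))"
proof -
  let ?w = "\<lambda>m x. indicator {-1..1} x *\<^sub>R (chebT m x / (pi * sqrt (1 - x\<^sup>2)))"
  have w_nonneg: "0 \<le> ?w 0 x" for x
    by (auto simp: chebT_def indicator_def abs_square_le_1 abs_le_iff intro!: mult_nonneg_nonneg)
  have "?w 0 = (\<lambda>x. if x \<in> {-1..1} then chebT 0 x / (pi * sqrt (1 - x\<^sup>2)) else 0)"
    by (auto simp: indicator_def)
  then have "(?w 0 has_integral 1) UNIV"
    using chebT_weight_has_integral[of 0] by (simp only: has_integral_restrict_UNIV simp_thms if_True)
  then have "(\<integral>\<^sup>+x. ennreal (?w 0 x) \<partial>lborel) = 1"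
    using nn_integral_has_integral_lborel[of "?w 0" 1] chebT_weight_measurable w_nonneg by simp
  then have "integrable lborel (?w 0)"
    using chebT_weight_measurable w_nonneg
    by (intro integrableI_nonneg) auto
  then have "integrable lborel (?w m)"
    by (rule Bochner_Integration.integrable_bound)
       (use chebT_weight_measurable in \<open>auto simp: chebT_def indicator_def abs_mult intro!: divide_right_mono\<close>)
  then show ?thesis unfolding set_integrable_def .
qed

lemma chebT_weight_integral:
  "(LINT x:{-1..1}|lborel. chebT m x / (pi * sqrt (1 - x\<^sup>2))) = (if m = 0 then 1 else 0)"
  using set_borel_integral_eq_integral(2)[OF chebT_weight_integrable] chebT_weight_has_integral
  by (simp add: integral_unique)

text \<open>
  The one-dimensional factor of the tensor product basis.
\<close>

definition normalized_chebT :: "nat \<Rightarrow> real \<Rightarrow> real" where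
  "normalized_chebT k x = (if k = 0 then 1 else sqrt 2) * chebT k x"

lemma sqrt2_power_nnz: "sqrt 2 ^ nnz d k = (\<Prod>j<d. if k j = 0 then 1 else sqrt 2)"
proof -
  have "(\<Prod>j<d. if k j = 0 then 1 else sqrt 2) = (\<Prod>j\<in>{j\<in>{..<d}. k j \<noteq> 0}. sqrt 2)"
    by (subst prod.inter_filter) (auto intro!: prod.cong)
  then show ?thesis by (simp add: nnz_def)
qed

lemma cheb_basis_eq_prod: "cheb_basis d k x = (\<Prod>j<d. normalized_chebT (k j) (x j))"
  unfolding cheb_basis_def sqrt2_power_nnz normalized_chebT_def by (simp add: prod.distrib)

text \<open>
  The product formula reduces the inner product of \<open>T\<^sub>k\<close> and \<open>T\<^sub>l\<close> to the integrals of
  \<open>T\<^bsub>l+k\<^esub>\<close> and \<open>T\<^bsub>l-k\<^esub>\<close>, of which only \<open>T\<^sub>0\<close> contributes. Both terms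
  contribute when \<open>k = l = 0\<close> but only one when \<open>k = l > 0\<close>, hence the factor
  \<open>sqrt 2\<close> for positive degrees.
\<close>

lemma normalized_chebT_orthonormal:
  defines "g \<equiv> \<lambda>k l x. normalized_chebT k x * normalized_chebT l x / (pi * sqrt (1 - x\<^sup>2))"
  shows "set_integrable lborel {-1..1} (g k l)"
    and "(LINT x:{-1..1}|lborel. g k l x) = (if k = l then 1 else 0)"
proof -
  let ?w = "\<lambda>m x. chebT m x / (pi * sqrt (1 - x\<^sup>2))"
  have *: "set_integrable lborel {-1..1} (g k l) \<and>
      (LINT x:{-1..1}|lborel. g k l x) = (if k = l then 1 else 0)" if "k \<le> l" for k l
  proof -
    define C where "C = (if k = 0 then 1 else sqrt 2) * (if l = 0 then 1 else sqrt 2) / 2"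
    have g: "g k l = (\<lambda>x. C * (?w (l + k) x + ?w (l - k) x))"
    proof
      fix x
      have "normalized_chebT k x * normalized_chebT l x = C * (chebT (l + k) x + chebT (l - k) x)"
        using chebT_mult[OF that, of x] by (simp add: normalized_chebT_def C_def)
      then show "g k l x = C * (?w (l + k) x + ?w (l - k) x)"
        by (simp add: g_def add_divide_distrib distrib_left)
    qed
    show ?thesis
      unfolding g using that chebT_weight_integrable
      by (auto simp: C_def set_integral_add chebT_weight_integral)
  qed
  have sym: "g k l = g l k"
    by (auto simp: g_def mult.commute)
  show "set_integrable lborel {-1..1} (g k l)"
    using *[of k l] *[of l k] sym by (cases "k \<le> l") auto
  show "(LINT x:{-1..1}|lborel. g k l x) = (if k = l then 1 else 0)"
    using *[of k l] *[of l k] sym by (cases "k \<le> l") auto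
qed

text \<open>
  On the cube the weight, the indicator and both basis functions factor over the coordinates, so the
  integral is a product of one-dimensional inner products.
\<close>

lemma cheb_coeff_basis:
  assumes "k \<in> {..<d} \<rightarrow>\<^sub>E UNIV" "l \<in> {..<d} \<rightarrow>\<^sub>E UNIV"
  shows "cheb_coeff d (cheb_basis d k) l = (if k = l then 1 else 0)"
proof -
  interpret product_sigma_finite "\<lambda>_::nat. lborel :: real measure" ..
  let ?M = "PiM {..<d} (\<lambda>_::nat. lborel :: real measure)"
  let ?u = "\<lambda>j x. indicator {-1..1} x *\<^sub>R (normalized_chebT (k j) x * normalized_chebT (l j) x)"
  let ?g = "\<lambda>j x. indicator {-1..1} x *\<^sub>R (normalized_chebT (k j) x * normalized_chebT (l j) x / (pi * sqrt (1 - x\<^sup>2)))"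
  \<comment> \<open>Off the cube the density quotient can be negative; \<open>ennreal\<close> cuts it off at \<open>0\<close>.\<close>
  let ?D = "\<lambda>x. max 0 (1 / (\<Prod>j<d. pi * sqrt (1 - (x j)\<^sup>2)))"
  have ind: "indicator (cube d) x = (\<Prod>j<d. indicator {-1..1} (x j) :: real)" if x: "x \<in> space ?M" for x
  proof (cases "x \<in> cube d")
    case True
    then show ?thesis by (auto simp: cube_def PiE_iff intro!: prod.neutral[symmetric])
  next
    case False
    then obtain j where "j < d" "x j \<notin> {-1..1}"
      using x by (auto simp: cube_def space_PiM PiE_iff)
    then have "(\<Prod>j<d. indicator {-1..1} (x j) :: real) = 0"
      by (intro prod_zero) (auto intro!: bexI[of _ j])
    then show ?thesis using False by simp
  qed
  have u: "indicator (cube d) x *\<^sub>R (cheb_basis d k x * cheb_basis d l x) = (\<Prod>j<d. ?u j (x j))"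
    if "x \<in> space ?M" for x
    using that by (simp add: ind cheb_basis_eq_prod prod.distrib)
  have [measurable]: "?u j \<in> borel_measurable borel" for j
    unfolding normalized_chebT_def
    by (intro borel_measurable_continuous_on_indicator continuous_intros continuous_on_chebT) simp
  have M: "cheb_measure d = density ?M (\<lambda>x. ennreal (?D x))"
    unfolding cheb_measure_def by (intro arg_cong[of _ _ "density ?M"] ext) (simp add: max_def ennreal_neg)
  have "cheb_coeff d (cheb_basis d k) l =
      (\<integral>x. indicator (cube d) x *\<^sub>R (cheb_basis d k x * cheb_basis d l x) \<partial>cheb_measure d)"
    by (simp add: cheb_coeff_def set_lebesgue_integral_def)
  also have "\<dots> = (\<integral>x. (\<Prod>j<d. ?u j (x j)) \<partial>cheb_measure d)"
    by (intro Bochner_Integration.integral_cong refl u) (simp add: cheb_measure_def)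
  also have "\<dots> = (\<integral>x. ?D x *\<^sub>R (\<Prod>j<d. ?u j (x j)) \<partial>?M)"
    unfolding M by (intro integral_density) measurable
  also have "\<dots> = (\<integral>x. (\<Prod>j<d. ?g j (x j)) \<partial>?M)"
  proof (intro Bochner_Integration.integral_cong refl)
    fix x assume x: "x \<in> space ?M"
    show "?D x *\<^sub>R (\<Prod>j<d. ?u j (x j)) = (\<Prod>j<d. ?g j (x j))"
    proof (cases "x \<in> cube d")
      case True
      then have "0 \<le> (\<Prod>j<d. pi * sqrt (1 - (x j)\<^sup>2))"
        by (intro prod_nonneg) (auto simp: cube_def PiE_iff abs_square_le_1 abs_le_iff)
      then show ?thesis
        by (simp add: prod.distrib prod_dividef)
    next
      case False
      then have "(\<Prod>j<d. indicator {-1..1} (x j) :: real) = 0" using ind[OF x] by simp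
      then show ?thesis by (simp add: prod.distrib prod_dividef del: prod_zero_iff)
    qed
  qed
  also have "\<dots> = (\<Prod>j<d. \<integral>x. ?g j x \<partial>lborel)"
    using normalized_chebT_orthonormal(1) by (intro product_integral_prod) (auto simp: set_integrable_def)
  also have "\<dots> = (\<Prod>j<d. if k j = l j then 1 else 0)"
    using normalized_chebT_orthonormal(2) by (simp add: set_lebesgue_integral_def)
  also have "\<dots> = (if k = l then 1 else 0)"
  proof (cases "k = l")
    case False
    then obtain j where "j < d" "k j \<noteq> l j" using PiE_ext[OF assms] by auto
    then show ?thesis using False by (auto simp: prod_zero_iff)
  qed simp
  finally show ?thesis .
qed

section \<open>Lattice sums of products of cosines\<close>

text \<open>
  The terms are the real parts of the powers of a root of unity; the geometric sum vanishes
  unless that root is \<open>1\<close>.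
\<close>

lemma sum_cos_lattice:
  fixes m :: int and n :: nat
  assumes "n \<ge> 1"
  shows "(\<Sum>i<n. cos (2 * pi * (real i * of_int m) / real n)) = (if int n dvd m then real n else 0)"
proof -
  define w where "w = cis (2 * pi * of_int m / real n)"
  have pow: "w ^ i = cis (2 * pi * (real i * of_int m) / real n)" for i
    unfolding w_def Complex.DeMoivre by (simp add: mult_ac)
  have re: "(\<Sum>i<n. cos (2 * pi * (real i * of_int m) / real n)) = Re (\<Sum>i<n. w ^ i)"
    by (simp add: pow)
  have wn: "w ^ n = 1"
  proof -
    have "2 * pi * (real n * of_int m) / real n = 2 * pi * of_int m"
      using assms by simp
    then show ?thesis unfolding pow by (simp only: cis_multiple_2pi Ints_of_int)
  qed
  show ?thesis
  proof (cases "int n dvd m")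
    case True
    then obtain q where "m = int n * q" by auto
    then have "2 * pi * of_int m / real n = 2 * pi * of_int q"
      using assms by simp
    then have "w = 1" unfolding w_def by (simp only: cis_multiple_2pi Ints_of_int)
    then show ?thesis using True re by simp
  next
    case False
    have "w \<noteq> 1"
    proof
      assume "w = 1"
      then have "cos (2 * pi * of_int m / real n) = 1" by (simp add: w_def complex_eq_iff)
      then obtain q :: int where "2 * pi * of_int m / real n = of_int q * 2 * pi"
        by (auto simp: cos_one_2pi_int)
      then have "real_of_int m = real_of_int (int n * q)"
        using assms by (simp add: field_simps)
      then have "m = int n * q" by (simp only: of_int_eq_iff)
      with False show False by simp
    qed
    then have "(\<Sum>i<n. w ^ i) = 0" using wn by (simp add: geometric_sum)
    with False re show ?thesis by simp
  qed
qed

lemma cos_cong: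
  fixes a b :: int and n :: nat
  assumes "n \<ge> 1" "[a = b] (mod int n)"
  shows "cos (2 * pi * of_int a / real n) = cos (2 * pi * of_int b / real n)"
proof -
  obtain q where "a = b + int n * q" using assms(2) by (metis cong_iff_lin cong_sym)
  then have "2 * pi * of_int a / real n = 2 * pi * of_int b / real n + 2 * pi * of_int q"
    using assms(1) by (simp add: field_simps)
  then show ?thesis using cos_int_2pin[of q] sin_int_2pin[of q]  by (simp add: cos_add)
qed

text \<open>
  In this form a product of coordinatewise sums expands into a sum over the sign set.
\<close>

lemma sign_set_eq_PiE: "sign_set d k = PiE {..<d} (\<lambda>j. if k j = 0 then {1} else {-1, 1})"
proof -
  have *: "\<sigma> j \<in> (if k j = 0 then {1} else {-1, 1}) \<longleftrightarrow> \<sigma> j \<in> {-1, 1} \<and> (k j = 0 \<longrightarrow> \<sigma> j = 1)"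
    for \<sigma> :: "nat \<Rightarrow> int" and j
    by (cases "k j = 0") auto
  then show ?thesis
    unfolding sign_set_def set_eq_iff mem_Collect_eq PiE_iff * by blast
qed

lemma finite_sign_set: "finite (sign_set d k)"
  unfolding sign_set_eq_PiE by (intro finite_PiE) auto

text \<open>
  Each factor with \<open>k\<^sub>j \<noteq> 0\<close> is half the sum of two conjugate exponentials; multiplying out gives one
  exponential for every sign vector. The sum of the exponentials is real because the sign set is
  symmetric, so the extra factor \<open>cos u\<close> may be replaced by \<open>cis (-u)\<close>. In this way only the
  difference frequency appears, and the congruences for \<open>+k\<close> and \<open>-k\<close> need not be
  counted separately.
\<close>

lemma prod_cos_sign_expansion:
  "2 ^ nnz d k * (\<Prod>j<d. cos (real (k j) * t j)) * cos u
   = (\<Sum>\<sigma>\<in>sign_set d k. cos ((\<Sum>j<d. of_int (\<sigma> j * int (k j)) * t j) - u))"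
proof -
  let ?B = "\<lambda>j. if k j = 0 then {1} else {-1, 1 :: int}"
  have cis_sum: "(\<Prod>j\<in>A. cis (a j)) = cis (\<Sum>j\<in>A. a j)" if "finite A" for A :: "nat set" and a
    using that by induction (auto simp: cis_mult)
  have two: "(2 :: complex) ^ nnz d k = (\<Prod>j<d. if k j = 0 then 1 else 2)"
  proof -
    have "(\<Prod>j<d. if k j = 0 then 1 else (2 :: complex)) = (\<Prod>j\<in>{j\<in>{..<d}. k j \<noteq> 0}. 2)"
      by (subst prod.inter_filter) (auto intro!: prod.cong)
    then show ?thesis by (simp add: nnz_def)
  qed
  have "(\<Sum>\<sigma>\<in>sign_set d k. cis (\<Sum>j<d. of_int (\<sigma> j * int (k j)) * t j))
      = (\<Prod>j<d. \<Sum>b\<in>?B j. cis (of_int (b * int (k j)) * t j))"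
    unfolding sign_set_eq_PiE by (subst prod_sum_PiE) (auto simp: cis_sum)
  also have "\<dots> = (\<Prod>j<d. (if k j = 0 then 1 else 2) * of_real (cos (real (k j) * t j)))"
    by (intro prod.cong refl) (auto simp: complex_eq_iff)
  also have "\<dots> = of_real (2 ^ nnz d k * (\<Prod>j<d. cos (real (k j) * t j)))"
    by (simp add: prod.distrib two)
  finally have *: "(\<Sum>\<sigma>\<in>sign_set d k. cis (\<Sum>j<d. of_int (\<sigma> j * int (k j)) * t j))
      = of_real (2 ^ nnz d k * (\<Prod>j<d. cos (real (k j) * t j)))" .
  have "(\<Sum>\<sigma>\<in>sign_set d k. cos ((\<Sum>j<d. of_int (\<sigma> j * int (k j)) * t j) - u))
      = Re (\<Sum>\<sigma>\<in>sign_set d k. cis (\<Sum>j<d. of_int (\<sigma> j * int (k j)) * t j) * cis (-u))"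
    by (simp only: Re_sum cis_mult cis.sel) simp
  also have "\<dots> = 2 ^ nnz d k * (\<Prod>j<d. cos (real (k j) * t j)) * cos u"
    by (simp only: sum_distrib_right[symmetric] * times_complex.sel Re_complex_of_real Im_complex_of_real cis.sel) simp
  finally show ?thesis by simp
qed

definition lattice_node :: "nat \<Rightarrow> nat \<Rightarrow> (nat \<Rightarrow> int) \<Rightarrow> nat \<Rightarrow> nat \<Rightarrow> real" where
  "lattice_node d n z i = (\<lambda>j\<in>{..<d}. real_of_int ((int i * z j) mod int n) / real n)"

lemma dot_cong_iff_dvd:
  "dot_cong d n a b z \<longleftrightarrow> int n dvd (\<Sum>j<d. (a j - b j) * z j)"
  unfolding dot_cong_def cong_iff_dvd_diff by (simp add: left_diff_distrib sum_subtractf)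

text \<open>
  Aliasing: after the sign expansion each summand is a wave with frequency \<open>\<sigma>(l) - k\<close>, which
  sums to \<open>n\<close> or to \<open>0\<close> over the lattice according to whether \<open>\<sigma>(l) \<cdot> z \<equiv> k \<cdot> z\<close>.
\<close>

lemma sum_lattice_prod_cos:
  assumes "n \<ge> 1"
  shows "(\<Sum>i<n. (\<Prod>j<d. cos (real (l j) * (2 * pi * lattice_node d n z i j))) *
              cos (2 * pi * (\<Sum>j<d. real (k j) * lattice_node d n z i j)))
       = real n / 2 ^ nnz d l *
           real (card {\<sigma> \<in> sign_set d l. dot_cong d n (sign_change d \<sigma> l) (\<lambda>j. int (k j)) z})"
    (is "(\<Sum>i<n. ?G i) = _ * real (card ?S)")
proof -
  let ?m = "\<lambda>\<sigma>. (\<Sum>j<d. (sign_change d \<sigma> l j - int (k j)) * z j)"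
  have step: "2 ^ nnz d l * ?G i = (\<Sum>\<sigma>\<in>sign_set d l. cos (2 * pi * (real i * of_int (?m \<sigma>)) / real n))"
    (is "_ = (\<Sum>\<sigma>\<in>_. ?c \<sigma>)") for i
  proof -
    have "2 ^ nnz d l * ?G i = (\<Sum>\<sigma>\<in>sign_set d l.
        cos ((\<Sum>j<d. of_int (\<sigma> j * int (l j)) * (2 * pi * lattice_node d n z i j))
            - 2 * pi * (\<Sum>j<d. real (k j) * lattice_node d n z i j)))"
      using prod_cos_sign_expansion[of d l "\<lambda>j. 2 * pi * lattice_node d n z i j"
          "2 * pi * (\<Sum>j<d. real (k j) * lattice_node d n z i j)"] by simp
    also have "\<dots> = (\<Sum>\<sigma>\<in>sign_set d l. ?c \<sigma>)"
    proof (intro sum.cong refl)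
      fix \<sigma>
      let ?a = "\<Sum>j<d. (sign_change d \<sigma> l j - int (k j)) * ((int i * z j) mod int n)"
      have "(\<Sum>j<d. of_int (\<sigma> j * int (l j)) * (2 * pi * lattice_node d n z i j))
            - 2 * pi * (\<Sum>j<d. real (k j) * lattice_node d n z i j) 
          = (\<Sum>j<d. of_int (\<sigma> j * int (l j)) * (2 * pi * lattice_node d n z i j)
                - 2 * pi * (real (k j) * lattice_node d n z i j))"
        by (simp only: sum_subtractf sum_distrib_left)
      also have "\<dots> = (\<Sum>j<d. 2 * pi / real n *
            of_int ((sign_change d \<sigma> l j - int (k j)) * ((int i * z j) mod int n)))"
        by (intro sum.cong refl)
           (simp add: lattice_node_def sign_change_def left_diff_distrib right_diff_distrib diff_divide_distrib)
      also have "\<dots> = 2 * pi * of_int ?a / real n"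
        by (simp only: of_int_sum sum_distrib_left[symmetric]) simp
      finally have "(\<Sum>j<d. of_int (\<sigma> j * int (l j)) * (2 * pi * lattice_node d n z i j))
            - 2 * pi * (\<Sum>j<d. real (k j) * lattice_node d n z i j) = 2 * pi * of_int ?a / real n" .
      \<comment> \<open>Reducing the nodes modulo \<open>1\<close> shifts the phase by a multiple of \<open>2\<pi>\<close>, as the frequency is integral.\<close>
      moreover have "[?a = (\<Sum>j<d. (sign_change d \<sigma> l j - int (k j)) * (int i * z j))] (mod int n)"
        by (intro cong_sum cong_scalar_left) (simp add: cong_def)
      moreover have "(\<Sum>j<d. (sign_change d \<sigma> l j - int (k j)) * (int i * z j)) = int i * ?m \<sigma>"
        unfolding sum_distrib_left by (intro sum.cong refl) (rule mult.left_commute)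
      ultimately show "cos ((\<Sum>j<d. of_int (\<sigma> j * int (l j)) * (2 * pi * lattice_node d n z i j))
            - 2 * pi * (\<Sum>j<d. real (k j) * lattice_node d n z i j)) = ?c \<sigma>"
        using cos_cong[OF assms, of ?a "int i * ?m \<sigma>"] by (simp only: of_int_mult of_int_of_nat_eq)
    qed
    finally show ?thesis .
  qed
  have "2 ^ nnz d l * (\<Sum>i<n. ?G i)
      = (\<Sum>\<sigma>\<in>sign_set d l. \<Sum>i<n. cos (2 * pi * (real i * of_int (?m \<sigma>)) / real n))"
    by (subst sum_distrib_left) (simp only: step, rule sum.swap)
  also have "\<dots> = (\<Sum>\<sigma>\<in>sign_set d l. if \<sigma> \<in> ?S then real n else 0)"
    by (intro sum.cong refl) (simp add: sum_cos_lattice[OF assms] dot_cong_iff_dvd del: of_int_sum)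
  also have "\<dots> = real n * real (card ?S)"
    by (subst sum.inter_filter[symmetric]) (auto simp: finite_sign_set)
  finally show ?thesis by (simp add: field_simps)
qed

section \<open>Exact reconstruction\<close>

text \<open>
  The number of mirror images of \<open>l\<close> that the lattice cannot distinguish from \<open>k\<close>. For
  \<open>l = k\<close> it is the normalising count of the discrete coefficient.
\<close>

definition alias_count :: "nat \<Rightarrow> nat \<Rightarrow> (nat \<Rightarrow> int) \<Rightarrow> (nat \<Rightarrow> nat) \<Rightarrow> (nat \<Rightarrow> nat) \<Rightarrow> nat" where
  "alias_count d n z k l =
     card {\<sigma> \<in> sign_set d l. dot_cong d n (sign_change d \<sigma> l) (\<lambda>j. int (k j)) z}"

text \<open>
  The sign vector without sign changes is always counted.
\<close>

lemma alias_count_pos: "alias_count d n z k k > 0"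
proof -
  let ?S = "{\<sigma> \<in> sign_set d k. dot_cong d n (sign_change d \<sigma> k) (\<lambda>j. int (k j)) z}"
  have "(\<lambda>j\<in>{..<d}. 1) \<in> ?S"
    by (simp add: sign_set_def dot_cong_def sign_change_def)
  moreover have "finite ?S" using finite_sign_set by simp
  ultimately show ?thesis unfolding alias_count_def card_gt_0_iff by blast
qed

lemma separating_iff_alias_count:
  "separating d n \<Lambda> z \<longleftrightarrow> (\<forall>k\<in>\<Lambda>. \<forall>l\<in>\<Lambda>. k \<noteq> l \<longrightarrow> alias_count d n z k l = 0)"
proof -
  have "alias_count d n z k l = 0
      \<longleftrightarrow> (\<forall>\<sigma>\<in>sign_set d l. \<not> dot_cong d n (sign_change d \<sigma> l) (\<lambda>j. int (k j)) z)" for k l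
    unfolding alias_count_def using finite_sign_set by (subst card_0_eq) auto
  then show ?thesis unfolding separating_def by blast
qed

lemma cheb_basis_cos:
  "cheb_basis d l (\<lambda>j\<in>{..<d}. cos (2 * pi * x j))
   = sqrt 2 ^ nnz d l * (\<Prod>j<d. cos (real (l j) * (2 * pi * x j)))"
  by (simp add: cheb_basis_def chebT_cos)

text \<open>
  The functional \<open>f \<mapsto> lattice_coeff d n z f k\<close> is linear, so it suffices to know its values on the basis
  functions. The function \<open>f\<close> matters on the cube only, because all nodes are mapped into it by the
  cosine.
\<close>

lemma lattice_coeff_expansion:
  assumes n: "n \<ge> 1" and f: "\<And>x. x \<in> cube d \<Longrightarrow> f x = (\<Sum>l\<in>\<Lambda>. c l * cheb_basis d l x)"
  shows "lattice_coeff d n z f k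
       = (\<Sum>l\<in>\<Lambda>. c l * (sqrt 2 ^ nnz d k / sqrt 2 ^ nnz d l * real (alias_count d n z k l)))
         / real (alias_count d n z k k)"
proof -
  let ?x = "lattice_node d n z"
  let ?P = "\<lambda>l i. \<Prod>j<d. cos (real (l j) * (2 * pi * ?x i j))"
  let ?C = "\<lambda>i. cos (2 * pi * (\<Sum>j<d. real (k j) * ?x i j))"
  have fx: "f (\<lambda>j\<in>{..<d}. cos (2 * pi * ?x i j)) = (\<Sum>l\<in>\<Lambda>. c l * (sqrt 2 ^ nnz d l * ?P l i))" for i
    by (subst f) (auto simp: cube_def cheb_basis_cos)
  have sq: "sqrt 2 ^ m / 2 ^ m = 1 / sqrt 2 ^ m" for m
  proof -
    have "(2 :: real) ^ m = sqrt 2 ^ m * sqrt 2 ^ m" by (simp flip: power_mult_distrib)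
    then show ?thesis by simp
  qed
  have "1 / real n * (\<Sum>i<n. f (\<lambda>j\<in>{..<d}. cos (2 * pi * ?x i j)) * (sqrt 2 ^ nnz d k * ?C i))
      = 1 / real n * (\<Sum>i<n. \<Sum>l\<in>\<Lambda>. c l * (sqrt 2 ^ nnz d l * sqrt 2 ^ nnz d k) * (?P l i * ?C i))"
    unfolding fx sum_distrib_right
    by (rule arg_cong[of _ _ "\<lambda>a. 1 / real n * a"]) (intro sum.cong refl, simp add: mult_ac)
  also have "\<dots> = (\<Sum>l\<in>\<Lambda>. c l * (sqrt 2 ^ nnz d l * sqrt 2 ^ nnz d k) / real n * (\<Sum>i<n. ?P l i * ?C i))"
    by (subst sum.swap) (simp add: sum_distrib_left)
  also have "\<dots> = (\<Sum>l\<in>\<Lambda>. c l * (sqrt 2 ^ nnz d k * (sqrt 2 ^ nnz d l / 2 ^ nnz d l) * real (alias_count d n z k l)))"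
    unfolding sum_lattice_prod_cos[OF n] alias_count_def using n by (intro sum.cong refl) simp
  finally show ?thesis
    unfolding lattice_coeff_def lattice_rule_def sq
    by (simp add: lattice_node_def sign_count_def alias_count_def)
qed

text \<open>
  If \<open>z\<close> separates, the expansion above collapses to its term at \<open>k\<close>. Conversely, basis
  function \<open>l\<close> has coefficient \<open>0\<close> at \<open>k \<noteq> l\<close>, while its discrete coefficient there is a
  positive multiple of the alias count.
\<close>

lemma reconstruction_iff_separating:
  assumes n: "n \<ge> 1" and fin: "finite \<Lambda>" and \<Lambda>: "\<Lambda> \<subseteq> {..<d} \<rightarrow>\<^sub>E UNIV"
  shows "(\<forall>f \<in> cheb_space d \<Lambda>. \<forall>k \<in> \<Lambda>. cheb_coeff d f k = lattice_coeff d n z f k)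
     \<longleftrightarrow> separating d n \<Lambda> z"
proof
  assume rec: "\<forall>f \<in> cheb_space d \<Lambda>. \<forall>k \<in> \<Lambda>. cheb_coeff d f k = lattice_coeff d n z f k"
  have "alias_count d n z k l = 0" if k: "k \<in> \<Lambda>" and l: "l \<in> \<Lambda>" and "k \<noteq> l" for k l
  proof -
    let ?c = "\<lambda>m. if l = m then 1 else 0 :: real"
    have c: "cheb_coeff d (cheb_basis d l) m = ?c m" if "m \<in> \<Lambda>" for m
      using cheb_coeff_basis that l \<Lambda> by blast
    have pick: "(\<Sum>m\<in>\<Lambda>. ?c m * g m) = g l" for g
      using fin l by (simp add: if_distrib[of "\<lambda>a. a * _"] cong: if_cong)
    have basis: "cheb_basis d l x = (\<Sum>m\<in>\<Lambda>. ?c m * cheb_basis d m x)" for x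
      by (simp only: pick)
    have "cheb_basis d l \<in> cheb_space d \<Lambda>"
      unfolding cheb_space_def by (simp add: c basis[symmetric] cong: sum.cong)
    then have "0 = lattice_coeff d n z (cheb_basis d l) k"
      using rec c[OF k] k \<open>k \<noteq> l\<close> by auto
    also have "\<dots> = sqrt 2 ^ nnz d k / sqrt 2 ^ nnz d l * real (alias_count d n z k l)
        / real (alias_count d n z k k)"
      unfolding lattice_coeff_expansion[OF n basis] pick ..
    finally show ?thesis using alias_count_pos[of d n z k] by simp
  qed
  then show "separating d n \<Lambda> z" by (simp add: separating_iff_alias_count)
next
  assume sep: "separating d n \<Lambda> z"
  show "\<forall>f \<in> cheb_space d \<Lambda>. \<forall>k \<in> \<Lambda>. cheb_coeff d f k = lattice_coeff d n z f k"
  proof (intro ballI)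
    fix f k assume f: "f \<in> cheb_space d \<Lambda>" and k: "k \<in> \<Lambda>"
    let ?t = "\<lambda>l. cheb_coeff d f l * (sqrt 2 ^ nnz d k / sqrt 2 ^ nnz d l * real (alias_count d n z k l))"
    have "?t l = 0" if "l \<in> \<Lambda> - {k}" for l
      using sep k that by (auto simp: separating_iff_alias_count)
    then have "(\<Sum>l\<in>\<Lambda> - {k}. ?t l) = 0"
      by (intro sum.neutral ballI)
    then have "(\<Sum>l\<in>\<Lambda>. ?t l) = ?t k"
      using sum.remove[OF fin k, of ?t] by (simp only: add_0_right)
    moreover have "lattice_coeff d n z f k = (\<Sum>l\<in>\<Lambda>. ?t l) / real (alias_count d n z k k)"
      using f by (intro lattice_coeff_expansion n) (simp add: cheb_space_def)
    ultimately show "cheb_coeff d f k = lattice_coeff d n z f k"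
      using alias_count_pos[of d n z k] by simp
  qed
qed

section \<open>Component-by-component construction\<close>

text \<open>
  Turning the existential projection into an image makes cardinality bounds immediate and shows
  that successive projections compose.
\<close>

lemma proj_index_eq_image:
  assumes "s \<le> d" "\<Lambda> \<subseteq> {..<d} \<rightarrow>\<^sub>E UNIV"
  shows "proj_index d s \<Lambda> = (\<lambda>k. restrict k {..<s}) ` \<Lambda>"
proof (intro equalityI subsetI)
  fix k assume "k \<in> proj_index d s \<Lambda>"
  then obtain k' where k: "k \<in> {..<s} \<rightarrow>\<^sub>E UNIV" and l: "merge {..<s} {s..<d} (k, k') \<in> \<Lambda>"
    by (auto simp: proj_index_def)
  have "restrict (merge {..<s} {s..<d} (k, k')) {..<s} = k"
  proof
    fix j
    show "restrict (merge {..<s} {s..<d} (k, k')) {..<s} j = k j"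
      using PiE_arb[OF k, of j] by (cases "j < s") (simp_all add: merge_def)
  qed
  then show "k \<in> (\<lambda>k. restrict k {..<s}) ` \<Lambda>" using l by (metis imageI)
next
  fix k assume "k \<in> (\<lambda>k. restrict k {..<s}) ` \<Lambda>"
  then obtain l where l: "l \<in> \<Lambda>" "k = restrict l {..<s}" by auto
  have "merge {..<s} {s..<d} (k, restrict l {s..<d}) = l"
  proof
    fix j
    have "l j = undefined" if "\<not> j < d" using l(1) assms(2) that by (auto simp: PiE_iff extensional_def)
    then show "merge {..<s} {s..<d} (k, restrict l {s..<d}) j = l j"
      using l(2) assms(1) by (auto simp: merge_def)
  qed
  then have "merge {..<s} {s..<d} (k, restrict l {s..<d}) \<in> \<Lambda>" using l(1) by simp
  moreover have "k \<in> {..<s} \<rightarrow>\<^sub>E UNIV" "restrict l {s..<d} \<in> {s..<d} \<rightarrow>\<^sub>E UNIV"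
    using l(2) by simp_all
  ultimately show "k \<in> proj_index d s \<Lambda>"
    unfolding proj_index_def by blast
qed

lemma mirroredI:
  "k \<in> \<Lambda> \<Longrightarrow> \<sigma> \<in> {..<d} \<rightarrow>\<^sub>E {-1, 1} \<Longrightarrow> sign_change d \<sigma> k \<in> mirrored d \<Lambda>"
  unfolding mirrored_def by blast

lemma mirrored_eq_image:
  "mirrored d \<Lambda> = (\<lambda>(\<sigma>, k). sign_change d \<sigma> k) ` (({..<d} \<rightarrow>\<^sub>E {-1, 1}) \<times> \<Lambda>)"
  unfolding mirrored_def by (auto simp: image_iff)

lemma finite_mirrored: "finite \<Lambda> \<Longrightarrow> finite (mirrored d \<Lambda>)"
  unfolding mirrored_eq_image by (intro finite_imageI finite_cartesian_product finite_PiE) auto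

text \<open>
  A sign vector of length \<open>s\<close> extends by \<open>+1\<close>, so projecting the index set cannot create
  more mirrored indices than there were.
\<close>

lemma mirrored_proj_subset:
  assumes "s \<le> d"
  shows "mirrored s ((\<lambda>k. restrict k {..<s}) ` \<Lambda>) \<subseteq> (\<lambda>h. restrict h {..<s}) ` mirrored d \<Lambda>"
proof
  fix h assume "h \<in> mirrored s ((\<lambda>k. restrict k {..<s}) ` \<Lambda>)"
  then obtain \<sigma> k where h: "h = sign_change s \<sigma> (restrict k {..<s})" "k \<in> \<Lambda>" "\<sigma> \<in> {..<s} \<rightarrow>\<^sub>E {-1, 1}"
    by (auto simp: mirrored_def)
  define \<tau> where "\<tau> = (\<lambda>j\<in>{..<d}. if j < s then \<sigma> j else 1)"
  have "\<tau> \<in> {..<d} \<rightarrow>\<^sub>E {-1, 1}" using h(3) by (auto simp: \<tau>_def PiE_iff)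
  then have "sign_change d \<tau> k \<in> mirrored d \<Lambda>" using h(2) by (rule mirroredI[rotated])
  moreover have "h = restrict (sign_change d \<tau> k) {..<s}"
    using assms h(1) by (auto simp: sign_change_def \<tau>_def fun_eq_iff)
  ultimately show "h \<in> (\<lambda>h. restrict h {..<s}) ` mirrored d \<Lambda>" by blast
qed

lemma card_linear_cong_solutions_le_1:
  fixes a c :: int
  assumes "prime n" "a \<noteq> 0" "\<bar>a\<bar> < int n"
  shows "card {w \<in> {1..int n - 1}. [a * w = c] (mod int n)} \<le> 1"
proof -
  have "\<not> int n dvd a" using assms(2,3) zdvd_imp_le[of "int n" "\<bar>a\<bar>"] by auto
  then have cop: "coprime a (int n)"
    using assms(1) prime_imp_coprime[of "int n" a] by (simp add: coprime_commute)
  have "w = w'" if "w \<in> {1..int n - 1}" "w' \<in> {1..int n - 1}" "[a * w = c] (mod int n)" "[a * w' = c] (mod int n)" for w w'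
  proof -
    have "[a * w = a * w'] (mod int n)" using that(3,4) cong_trans cong_sym by blast
    then have "[w = w'] (mod int n)" using cop by (simp add: cong_mult_lcancel)
    then show ?thesis using that(1,2) by (auto simp: cong_def)
  qed
  moreover have "finite {w \<in> {1..int n - 1}. [a * w = c] (mod int n)}"
    by (rule finite_subset[of _ "{1..int n - 1}"]) auto
  ultimately show ?thesis
    unfolding One_nat_def by (subst card_le_Suc0_iff_eq) blast+
qed

text \<open>
  The counting argument. A collision in the new dimension is a pair of an index \<open>k\<close> and a
  mirrored index \<open>h\<close>. If their last entries agree, it would restrict to a collision in dimension
  \<open>s\<close>; otherwise it excludes at most one value of the new component. The crude bound
  on the number of pairs would allow all \<open>n - 1\<close> candidates to be excluded. It becomes strict because
  the pair of an index with itself has equal last entries and excludes nothing.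
\<close>

lemma separating_extension:
  fixes s n :: nat and \<Lambda> :: "(nat \<Rightarrow> nat) set"
  assumes n: "prime n" "card \<Lambda> * card (mirrored (Suc s) \<Lambda>) < n"
    and small: "\<And>k. k \<in> \<Lambda> \<Longrightarrow> 2 * k s < n"
    and fin: "finite \<Lambda>" and \<Lambda>: "\<Lambda> \<subseteq> {..<Suc s} \<rightarrow>\<^sub>E UNIV"
    and sep: "separating s n ((\<lambda>k. restrict k {..<s}) ` \<Lambda>) z"
  shows "\<exists>w \<in> {1..int n - 1}. separating (Suc s) n \<Lambda> (z(s := w))"
proof (cases "\<Lambda> = {}")
  case True
  have "n \<ge> 2" using n(1) by (rule prime_ge_2_nat)
  then show ?thesis using True by (intro bexI[of _ 1]) (auto simp: separating_def)
next
  case False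
  let ?M = "mirrored (Suc s) \<Lambda>"
  define P where "P = {(k, h) \<in> \<Lambda> \<times> ?M. h s \<noteq> int (k s)}"
  define B where "B = (\<lambda>(k :: nat \<Rightarrow> nat, h). {w \<in> {1..int n - 1}.
      [(h s - int (k s)) * w = (\<Sum>j<s. int (k j) * z j) - (\<Sum>j<s. h j * z j)] (mod int n)})"
  have finP: "finite (\<Lambda> \<times> ?M)" using fin finite_mirrored by blast
  have "card P < card (\<Lambda> \<times> ?M)"
  proof (intro psubset_card_mono finP psubsetI)
    obtain k where k: "k \<in> \<Lambda>" using False by auto
    have "sign_change (Suc s) (\<lambda>j\<in>{..<Suc s}. 1) k \<in> ?M"
      using k by (rule mirroredI) simp
    then have "(k, sign_change (Suc s) (\<lambda>j\<in>{..<Suc s}. 1) k) \<in> \<Lambda> \<times> ?M" using k by simp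
    moreover have "(k, sign_change (Suc s) (\<lambda>j\<in>{..<Suc s}. 1) k) \<notin> P"
      by (simp add: P_def sign_change_def)
    ultimately show "P \<noteq> \<Lambda> \<times> ?M" by metis
    show "P \<subseteq> \<Lambda> \<times> ?M" unfolding P_def by blast
  qed
  then have cardP: "card P < n - 1" using n(2) by (simp add: card_cartesian_product)
  have B1: "card (B p) \<le> 1" if p_in: "p \<in> P" for p
  proof -
    obtain k h where p: "p = (k, h)" and k: "k \<in> \<Lambda>" and "h \<in> ?M" and ne: "h s \<noteq> int (k s)"
      using p_in unfolding P_def by blast
    then obtain \<sigma> k' where "h = sign_change (Suc s) \<sigma> k'" and k': "k' \<in> \<Lambda>" "\<sigma> \<in> {..<Suc s} \<rightarrow>\<^sub>E {-1, 1}"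
      unfolding mirrored_def by blast
    then have "h s = \<sigma> s * int (k' s)" "\<sigma> s \<in> {-1, 1}"
      using PiE_mem[OF k'(2), of s] by (simp_all add: sign_change_def)
    then have "\<bar>h s\<bar> = int (k' s)" by (elim insertE) simp_all
    then have "\<bar>h s - int (k s)\<bar> < int n" using small[OF k] small[OF k'(1)] by linarith
    then show ?thesis
      unfolding B_def p using ne card_linear_cong_solutions_le_1[OF n(1)] by simp
  qed
  have "finite P" using finP by (rule finite_subset[rotated]) (unfold P_def, blast)
  then have "card (\<Union>p\<in>P. B p) \<le> (\<Sum>p\<in>P. card (B p))" by (rule card_UN_le)
  also have "\<dots> \<le> card P" using sum_mono[of P "\<lambda>p. card (B p)" "\<lambda>_. 1"] B1 by simp
  finally have lt: "card (\<Union>p\<in>P. B p) < card {1..int n - 1}" using cardP by simp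
  obtain w where w: "w \<in> {1..int n - 1}" "w \<notin> (\<Union>p\<in>P. B p)"
  proof -
    have "\<not> {1..int n - 1} \<subseteq> (\<Union>p\<in>P. B p)"
    proof
      assume "{1..int n - 1} \<subseteq> (\<Union>p\<in>P. B p)"
      moreover have "(\<Union>p\<in>P. B p) \<subseteq> {1..int n - 1}" unfolding B_def by blast
      ultimately have "(\<Union>p\<in>P. B p) = {1..int n - 1}" by (rule subset_antisym[rotated])
      then show False using lt by (simp only: less_irrefl)
    qed
    then show ?thesis using that by blast
  qed
  have "separating (Suc s) n \<Lambda> (z(s := w))"
    unfolding separating_def
  proof (intro ballI impI notI)
    fix k k' \<sigma> assume k: "k \<in> \<Lambda>" and k': "k' \<in> \<Lambda>" and \<sigma>: "\<sigma> \<in> sign_set (Suc s) k'" and ne: "k \<noteq> k'"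
      and "dot_cong (Suc s) n (sign_change (Suc s) \<sigma> k') (\<lambda>j. int (k j)) (z(s := w))"
    define h where "h = sign_change (Suc s) \<sigma> k'"
    have hM: "h \<in> ?M" using k' \<sigma> unfolding h_def sign_set_def by (intro mirroredI) simp_all
    have hs: "h s = \<sigma> s * int (k' s)" by (simp add: h_def sign_change_def)
    have cong: "[(\<Sum>j<s. h j * z j) + h s * w = (\<Sum>j<s. int (k j) * z j) + int (k s) * w] (mod int n)"
      using \<open>dot_cong _ _ _ _ _\<close> by (simp add: dot_cong_def h_def)
    show False
    proof (cases "h s = int (k s)")
      case True
      have "\<sigma> s \<in> {-1, 1}" using \<sigma> PiE_mem[of \<sigma> "{..<Suc s}" "\<lambda>_. {-1, 1}" s] by (simp add: sign_set_def)
      then have "k s = k' s" using True hs by (elim insertE) simp_all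
      have "restrict k {..<s} \<noteq> restrict k' {..<s}"
      proof
        assume eq: "restrict k {..<s} = restrict k' {..<s}"
        have "k j = k' j" if "j < Suc s" for j
          using that \<open>k s = k' s\<close> fun_cong[OF eq, of j] by (cases "j = s") auto
        then have "k = k'" using k k' \<Lambda> by (intro PiE_ext[of k "{..<Suc s}" "\<lambda>_. UNIV" k']) blast+
        with ne show False by simp
      qed
      moreover have "restrict \<sigma> {..<s} \<in> sign_set s (restrict k' {..<s})"
        using \<sigma> unfolding sign_set_def PiE_iff by simp
      ultimately have "\<not> dot_cong s n (sign_change s (restrict \<sigma> {..<s}) (restrict k' {..<s}))
          (\<lambda>j. int (restrict k {..<s} j)) z"
        using sep k k' unfolding separating_def by blast
      then have "\<not> [(\<Sum>j<s. h j * z j) = (\<Sum>j<s. int (k j) * z j)] (mod int n)"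
        by (simp add: dot_cong_def h_def sign_change_def)
      then show False using cong True by (simp add: cong_add_rcancel)
    next
      case False
      then have "(k, h) \<in> P" using k hM by (simp add: P_def)
      moreover have "w \<in> B (k, h)"
        using cong w(1) by (simp add: B_def cong_iff_dvd_diff algebra_simps)
      ultimately show False using w(2) by blast
    qed
  qed
  then show ?thesis using w(1) by blast
qed

text \<open>
  The bound on \<open>n\<close> is stated for \<open>\<Lambda>\<close> but applies to every projection, since projecting
  increases neither the two cardinalities nor the entries.
\<close>

lemma separating_cbc_step:
  assumes fin: "finite \<Lambda>" and \<Lambda>: "\<Lambda> \<subseteq> {..<d} \<rightarrow>\<^sub>E UNIV"
    and n: "prime n" "n > max (card \<Lambda> * card (mirrored d \<Lambda>)) (2 * max_index d \<Lambda>)"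
    and s: "s < d" and sep: "separating s n (proj_index d s \<Lambda>) z"
  shows "\<exists>w \<in> {1..int n - 1}. separating (Suc s) n (proj_index d (Suc s) \<Lambda>) (z(s := w))"
proof -
  let ?\<Lambda> = "proj_index d (Suc s) \<Lambda>"
  have img: "?\<Lambda> = (\<lambda>k. restrict k {..<Suc s}) ` \<Lambda>"
    using s \<Lambda> by (intro proj_index_eq_image) auto
  have "card (mirrored (Suc s) ?\<Lambda>) \<le> card (mirrored d \<Lambda>)"
    using mirrored_proj_subset[of "Suc s" d \<Lambda>] s finite_mirrored[OF fin, of d] unfolding img
    by (meson Suc_leI card_image_le card_mono finite_imageI le_trans)
  moreover have "card ?\<Lambda> \<le> card \<Lambda>"
    unfolding img using fin by (rule card_image_le)
  ultimately have count: "card ?\<Lambda> * card (mirrored (Suc s) ?\<Lambda>) < n"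
    using n(2) mult_le_mono by (metis le_less_trans max_less_iff_conj)
  have small: "2 * k s < n" if k: "k \<in> ?\<Lambda>" for k
  proof -
    obtain l where l: "l \<in> \<Lambda>" "k = restrict l {..<Suc s}" using k unfolding img by blast
    have "{k j |k j. k \<in> \<Lambda> \<and> j < d} = (\<lambda>(k, j). k j) ` (\<Lambda> \<times> {..<d})" by auto
    then have "finite {k j |k j. k \<in> \<Lambda> \<and> j < d}" using fin by simp
    moreover have "l s \<in> {k j |k j. k \<in> \<Lambda> \<and> j < d}" using l(1) s by blast
    ultimately have "l s \<le> max_index d \<Lambda>"
      unfolding max_index_def by (intro Max_ge) auto
    then show ?thesis using n(2) l(2) by simp
  qed
  have "(\<lambda>k. restrict k {..<s}) ` ?\<Lambda> = (\<lambda>k. restrict k {..<s}) ` \<Lambda>"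
    unfolding img image_image by (intro image_cong refl) auto
  also have "\<dots> = proj_index d s \<Lambda>"
    using s \<Lambda> by (intro proj_index_eq_image[symmetric]) auto
  finally have "separating s n ((\<lambda>k. restrict k {..<s}) ` ?\<Lambda>) z" using sep by simp
  moreover have "?\<Lambda> \<subseteq> {..<Suc s} \<rightarrow>\<^sub>E UNIV" unfolding proj_index_def by blast
  moreover have "finite ?\<Lambda>" unfolding img using fin by (rule finite_imageI)
  ultimately show ?thesis
    using n(1) count small by (intro separating_extension)
qed

theorem lemma21:
  fixes d n :: nat and \<Lambda> :: "(nat \<Rightarrow> nat) set"
  assumes "d \<ge> 1" and "n \<ge> 1"
    and "finite \<Lambda>" and "\<Lambda> \<subseteq> {..<d} \<rightarrow>\<^sub>E UNIV"
  shows "(\<forall>z \<in> {..<d} \<rightarrow>\<^sub>E UNIV.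
            (\<forall>f \<in> cheb_space d \<Lambda>. \<forall>k \<in> \<Lambda>. cheb_coeff d f k = lattice_coeff d n z f k)
            \<longleftrightarrow> separating d n \<Lambda> z) \<and>
         (prime n \<and> n > max (card \<Lambda> * card (mirrored d \<Lambda>)) (2 * max_index d \<Lambda>) \<longrightarrow>
            (\<forall>s<d. \<forall>z \<in> {..<s} \<rightarrow>\<^sub>E {1..int n - 1}.
               separating s n (proj_index d s \<Lambda>) z \<longrightarrow>
               (\<exists>zs \<in> {1..int n - 1}.
                  separating (Suc s) n (proj_index d (Suc s) \<Lambda>) (z(s := zs)))) \<and>
            (\<exists>z \<in> {..<d} \<rightarrow>\<^sub>E {1..int n - 1}. separating d n \<Lambda> z))"
proof (intro conjI ballI impI allI)
  fix z
  show "(\<forall>f \<in> cheb_space d \<Lambda>. \<forall>k \<in> \<Lambda>. cheb_coeff d f k = lattice_coeff d n z f k)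
     \<longleftrightarrow> separating d n \<Lambda> z"
    by (rule reconstruction_iff_separating) fact+
next
  fix s z
  assume "prime n \<and> n > max (card \<Lambda> * card (mirrored d \<Lambda>)) (2 * max_index d \<Lambda>)"
    and "s < d" "separating s n (proj_index d s \<Lambda>) z"
  then show "\<exists>zs \<in> {1..int n - 1}. separating (Suc s) n (proj_index d (Suc s) \<Lambda>) (z(s := zs))"
    using separating_cbc_step assms(3,4) by blast
next
  assume n: "prime n \<and> n > max (card \<Lambda> * card (mirrored d \<Lambda>)) (2 * max_index d \<Lambda>)"
  have "\<exists>z \<in> {..<s} \<rightarrow>\<^sub>E {1..int n - 1}. separating s n (proj_index d s \<Lambda>) z" if "s \<le> d" for s
    using that
  proof (induction s)
    case 0
    have "separating 0 n (proj_index d 0 \<Lambda>) (\<lambda>_. undefined)"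
      by (auto simp: separating_def proj_index_def)
    then show ?case by auto
  next
    case (Suc s)
    then obtain z where z: "z \<in> {..<s} \<rightarrow>\<^sub>E {1..int n - 1}" "separating s n (proj_index d s \<Lambda>) z"
      by auto
    then obtain w where "w \<in> {1..int n - 1}"
        "separating (Suc s) n (proj_index d (Suc s) \<Lambda>) (z(s := w))"
      using separating_cbc_step[OF assms(3,4)] n Suc.prems by (meson Suc_le_lessD)
    moreover have "z(s := w) \<in> {..<Suc s} \<rightarrow>\<^sub>E {1..int n - 1}"
      using z(1) \<open>w \<in> _\<close> by (simp add: lessThan_Suc PiE_fun_upd)
    ultimately show ?case by blast
  qed
  moreover have "proj_index d d \<Lambda> = \<Lambda>"
  proof -
    have "restrict k {..<d} = k" if "k \<in> \<Lambda>" for k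
      using assms(4) that by (auto simp: PiE_iff extensional_restrict)
    then show ?thesis using assms(4) by (simp add: proj_index_eq_image)
  qed
  ultimately show "\<exists>z \<in> {..<d} \<rightarrow>\<^sub>E {1..int n - 1}. separating d n \<Lambda> z"
    by (metis order_refl)
qed

end
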